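(* The single-level binary linear program (SL) is a valid formulation for the team formation problem (TFP), where (SL), in the binary variables $x_{i,k}$ ($i\in\mathcal N,k\in\mathcal M$), $w_{i,j}$ ($i,j\in\mathcal N$, $i\ne j$), $z_{i,v}$ ($i\in\mathcal N$, $v\in\{0,1,\dots,\mathcal U(i)\}$) and the real variable $r$, is $$\max\ \alpha\sum_{i\in\mathcal N}\sum_{j\in\mathcal N,\,j\neq i}u_{i,j}w_{i,j}-(1-\alpha)\,r$$ subject to $$\sum_{i\in\mathcal N}x_{i,k}=s\quad\forall k\in\mathcal M,\qquad \sum_{k\in\mathcal M}x_{i,k}=1\quad\forall i\in\mathcal N,$$ $$w_{i,j}\ge x_{i,k}+x_{j,k}-1,\qquad w_{i,j}+x_{i,k}\le x_{j,k}+1\qquad\forall i\ne j\in\mathcal N,\ \forall k\in\mathcal M,$$ $$\sum_{v=0}^{\mathcal U(i)}z_{i,v}=1,\qquad \sum_{v=0}^{\mathcal U(i)}v\,z_{i,v}=\sum_{j\in\mathcal N,\,j\ne i}u_{i,j}w_{i,j}\qquad\forall i\in\mathcal N,$$ $$r\ \ge\ \mathsf u(c)-\sum_{i\in c}\sum_{v=0}^{\mathcal U(i)}v\,z_{i,v}-\sum_{i\in c}\ \sum_{v=\mathsf u(c,i)+1}^{\mathcal U(i)}\mathsf u(c)\,z_{i,v}\qquad\forall c\in\mathcal C,$$ $$x_{i,k},\,w_{i,j},\,z_{i,v}\in\{0,1\}.$$ That is: the $x$-parts of feasible solutions of (SL) are exactly the vectors given by $x_{i,k}=1\Leftrightarrow\mathsf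 t(i)=k$ for $\mathsf t\in\mathcal T$, and for each such corresponding pair $(x,\mathsf t)$ the maximum of the (SL) objective over all feasible solutions with this $x$ equals the (TFP) objective value of $\mathsf t$.
   Context: Let $n,m,s$ be positive integers with $n=ms$, $\mathcal N=\{1,\dots,n\}$ (agents), $\mathcal M=\{1,\dots,m\}$ (teams). For $i,j\in\mathcal N$, $u_{i,j}$ is a nonnegative integer (pairwise utility of $i$ for being teamed with $j$), with $u_{i,i}=0$; $u$ need not be symmetric. Let $\alpha\in[0,1]$. A team formation is a map $\mathsf t:\mathcal N\to\mathcal M$ with $|\{i:\mathsf t(i)=k\}|=s$ for every $k\in\mathcal M$; $\mathcal T$ is the set of all team formations. Let $\mathsf c(\mathsf t,i)=\{j:\mathsf t(j)=\mathsf t(i)\}$. Let $\mathcal C$ be the family of all $s$-element subsets of $\mathcal N$ (coalitions) and $\mathcal C(i)=\{c\in\mathcal C:i\in c\}$. For $c\in\mathcal C(i)$ put $\mathsf u(c,i)=\sum_{j\in c}u_{i,j}$; put $\mathsf u(c)=\sum_{i\in c}\sum_{j\in c}u_{i,j}$, $\mathsf u(\mathsf t,i)=\mathsf u(\mathsf c(\mathsf t,i),i)$ and $\mathcal U(i)=\max_{c\in\mathcal C(i)}\mathsf u(c,i)$. Empty sums are $0$. For $\mathsf t\in\mathcal T$ and $c\in\mathcal C$ let $r(c,\mathsf t)=\sum_{i\in c}(\mathsf u(c,i)-\mathsf u(\mathsf t,i))$. The maximum uplift of $\mathsf t$ is $\max\{r(c,\mathsf t): c\in\mathcal C,\ \mathsf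 u(c,i)\ge\mathsf u(\mathsf t,i)\text{ for all }i\in c\}$. The team formation problem (TFP) is $$\max_{\mathsf t\in\mathcal T}\ \alpha\sum_{i\in\mathcal N}\mathsf u(\mathsf t,i)-(1-\alpha)\,r,\qquad r=\text{the maximum uplift of }\mathsf t.$$ *)

theory Defs
  imports Complex_Main "HOL-Library.FuncSet"
begin

definition agents :: "nat \<Rightarrow> nat set" where
  "agents n = {1..n}"

definition teams :: "nat \<Rightarrow> nat set" where
  "teams m = {1..m}"

(* Extensional functions, so that every map from agents to teams is represented exactly once. *)
definition team_formations :: "nat \<Rightarrow> nat \<Rightarrow> nat \<Rightarrow> (nat \<Rightarrow> nat) set" where
  "team_formations n m s =
     {t \<in> agents n \<rightarrow>\<^sub>E teams m. \<forall>k\<in>teams m. card {i \<in> agents n. t i = k} = s}"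

definition own_team :: "nat \<Rightarrow> (nat \<Rightarrow> nat) \<Rightarrow> nat \<Rightarrow> nat set" where
  "own_team n t i = {j \<in> agents n. t j = t i}"

definition coalitions :: "nat \<Rightarrow> nat \<Rightarrow> nat set set" where
  "coalitions n s = {c. c \<subseteq> agents n \<and> card c = s}"

definition coalitions_of :: "nat \<Rightarrow> nat \<Rightarrow> nat \<Rightarrow> nat set set" where
  "coalitions_of n s i = {c \<in> coalitions n s. i \<in> c}"

definition member_utility :: "(nat \<Rightarrow> nat \<Rightarrow> nat) \<Rightarrow> nat set \<Rightarrow> nat \<Rightarrow> nat" where
  "member_utility u c i = (\<Sum>j\<in>c. u i j)"

definition coalition_utility :: "(nat \<Rightarrow> nat \<Rightarrow> nat) \<Rightarrow> nat set \<Rightarrow> nat" where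
  "coalition_utility u c = (\<Sum>i\<in>c. \<Sum>j\<in>c. u i j)"

definition agent_utility :: "nat \<Rightarrow> (nat \<Rightarrow> nat \<Rightarrow> nat) \<Rightarrow> (nat \<Rightarrow> nat) \<Rightarrow> nat \<Rightarrow> nat" where
  "agent_utility n u t i = member_utility u (own_team n t i) i"

definition max_utility :: "nat \<Rightarrow> nat \<Rightarrow> (nat \<Rightarrow> nat \<Rightarrow> nat) \<Rightarrow> nat \<Rightarrow> nat" where
  "max_utility n s u i = Max {member_utility u c i | c. c \<in> coalitions_of n s i}"

definition uplift :: "nat \<Rightarrow> (nat \<Rightarrow> nat \<Rightarrow> nat) \<Rightarrow> nat set \<Rightarrow> (nat \<Rightarrow> nat) \<Rightarrow> int" where
  "uplift n u c t = (\<Sum>i\<in>c. int (member_utility u c i) - int (agent_utility n u t i))"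

(* For a team formation t with s > 0 the set below is finite, and it is nonempty because it
   contains the value of every team of t. *)
definition max_uplift :: "nat \<Rightarrow> nat \<Rightarrow> (nat \<Rightarrow> nat \<Rightarrow> nat) \<Rightarrow> (nat \<Rightarrow> nat) \<Rightarrow> int" where
  "max_uplift n s u t =
     Max {uplift n u c t | c. c \<in> coalitions n s \<and>
            (\<forall>i\<in>c. member_utility u c i \<ge> agent_utility n u t i)}"

definition TFP_objective ::
  "nat \<Rightarrow> nat \<Rightarrow> (nat \<Rightarrow> nat \<Rightarrow> nat) \<Rightarrow> real \<Rightarrow> (nat \<Rightarrow> nat) \<Rightarrow> real" where
  "TFP_objective n s u \<alpha> t =
     \<alpha> * (\<Sum>i\<in>agents n. real (agent_utility n u t i))
       - (1 - \<alpha>) * real_of_int (max_uplift n s u t)"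

(* The variables of the linear program are total functions. Only the entries x i k with i an agent
   and k a team, w i j with i, j distinct agents, and z i v with v at most max_utility n s u i
   belong to the program; all other entries are unconstrained and never used. *)

definition SL_feasible ::
  "nat \<Rightarrow> nat \<Rightarrow> nat \<Rightarrow> (nat \<Rightarrow> nat \<Rightarrow> nat) \<Rightarrow>
   (nat \<Rightarrow> nat \<Rightarrow> real) \<Rightarrow> (nat \<Rightarrow> nat \<Rightarrow> real) \<Rightarrow> (nat \<Rightarrow> nat \<Rightarrow> real) \<Rightarrow> real \<Rightarrow> bool" where
  "SL_feasible n m s u x w z r \<longleftrightarrow>
     (\<forall>k\<in>teams m. (\<Sum>i\<in>agents n. x i k) = real s) \<and>
     (\<forall>i\<in>agents n. (\<Sum>k\<in>teams m. x i k) = 1) \<and>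
     (\<forall>i\<in>agents n. \<forall>j\<in>agents n. i \<noteq> j \<longrightarrow>
        (\<forall>k\<in>teams m. w i j \<ge> x i k + x j k - 1 \<and> w i j + x i k \<le> x j k + 1)) \<and>
     (\<forall>i\<in>agents n. (\<Sum>v = 0..max_utility n s u i. z i v) = 1) \<and>
     (\<forall>i\<in>agents n. (\<Sum>v = 0..max_utility n s u i. real v * z i v)
                     = (\<Sum>j\<in>agents n - {i}. real (u i j) * w i j)) \<and>
     (\<forall>c\<in>coalitions n s.
        r \<ge> real (coalition_utility u c)
             - (\<Sum>i\<in>c. \<Sum>v = 0..max_utility n s u i. real v * z i v)
             - (\<Sum>i\<in>c. \<Sum>v = member_utility u c i + 1..max_utility n s u i.
                  real (coalition_utility u c) * z i v)) \<and>
     (\<forall>i\<in>agents n. \<forall>k\<in>teams m. x i k \<in> {0, 1}) \<and>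
     (\<forall>i\<in>agents n. \<forall>j\<in>agents n. i \<noteq> j \<longrightarrow> w i j \<in> {0, 1}) \<and>
     (\<forall>i\<in>agents n. \<forall>v\<in>{0..max_utility n s u i}. z i v \<in> {0, 1})"

definition SL_objective ::
  "nat \<Rightarrow> (nat \<Rightarrow> nat \<Rightarrow> nat) \<Rightarrow> real \<Rightarrow> (nat \<Rightarrow> nat \<Rightarrow> real) \<Rightarrow> real \<Rightarrow> real" where
  "SL_objective n u \<alpha> w r =
     \<alpha> * (\<Sum>i\<in>agents n. \<Sum>j\<in>agents n - {i}. real (u i j) * w i j) - (1 - \<alpha>) * r"

definition represents :: "nat \<Rightarrow> nat \<Rightarrow> (nat \<Rightarrow> nat \<Rightarrow> real) \<Rightarrow> (nat \<Rightarrow> nat) \<Rightarrow> bool" where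
  "represents n m x t \<longleftrightarrow>
     (\<forall>i\<in>agents n. \<forall>k\<in>teams m. x i k \<in> {0, 1} \<and> (x i k = 1 \<longleftrightarrow> t i = k))"

definition is_maximum :: "real set \<Rightarrow> real \<Rightarrow> bool" where
  "is_maximum A a \<longleftrightarrow> a \<in> A \<and> (\<forall>b\<in>A. b \<le> a)"

end

(* Given x, the constraints determine w and z: w is the indicator of being teammates, and z is the
   one-hot encoding of the utilities. In the constraint on r for a coalition c, the last sum
   vanishes if no member of c loses by deviating, which leaves r \<ge> uplift of c; otherwise it is at
   least the utility of c, so the right-hand side is nonpositive. The latter constraints are
   redundant because each team of t has uplift 0, so the maximum uplift is nonnegative. Hence
   feasibility amounts to r being at least the maximum uplift. *)

theory Submission
  imports Defs
begin

text \<open>Some entry is nonzero, hence 1; the remaining entries are nonnegative with sum 0, so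
  they vanish. This decodes both the rows of \<open>x\<close> and the rows of
  \<open>z\<close>.\<close>

lemma binary_sum_one_imp_one_hot:
  fixes f :: "'a \<Rightarrow> real"
  assumes fin: "finite A" and bin: "\<forall>a\<in>A. f a \<in> {0, 1}" and one: "sum f A = 1"
  shows "\<exists>a\<in>A. \<forall>b\<in>A. f b = of_bool (b = a)"
proof -
  obtain a where a: "a \<in> A" "f a \<noteq> 0"
    using one by (metis sum.neutral zero_neq_one)
  then have fa: "f a = 1" using bin by auto
  have "sum f (A - {a}) = 0"
    using one fa a fin by (simp add: sum_diff1)
  moreover have "\<forall>b\<in>A - {a}. f b \<ge> 0" using bin by fastforce
  ultimately have "\<forall>b\<in>A - {a}. f b = 0"
    using fin by (subst (asm) sum_nonneg_eq_0_iff) auto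
  then show ?thesis using a fa by (intro bexI[of _ a]) auto
qed

section \<open>Coalitions, utility bounds and the maximum uplift\<close>

lemma finite_agents [simp]: "finite (agents n)"
  by (simp add: agents_def)

lemma finite_teams [simp]: "finite (teams m)"
  by (simp add: teams_def)

lemma finite_coalitions [simp]: "finite (coalitions n s)"
  by (rule finite_subset[of _ "Pow (agents n)"]) (auto simp: coalitions_def)

lemma finite_coalition: "c \<in> coalitions n s \<Longrightarrow> finite c"
  unfolding coalitions_def by (auto intro: finite_subset[OF _ finite_agents])

lemma own_team_in_coalitions_of:
  assumes "t \<in> team_formations n m s" and "i \<in> agents n"
  shows "own_team n t i \<in> coalitions_of n s i"
  using assms
  by (auto simp: team_formations_def own_team_def coalitions_of_def coalitions_def PiE_iff)

lemma member_utility_le_max_utility: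
  assumes "c \<in> coalitions_of n s i"
  shows "member_utility u c i \<le> max_utility n s u i"
proof -
  have "finite (coalitions_of n s i)"
    by (rule finite_subset[OF _ finite_coalitions]) (auto simp: coalitions_of_def)
  then show ?thesis
    unfolding max_utility_def using assms by (intro Max_ge) auto
qed

text \<open>Ensures that the index range of \<open>z i\<close> contains the utility that agent
  \<open>i\<close> has under \<open>t\<close>.\<close>

lemma agent_utility_le_max_utility:
  assumes "t \<in> team_formations n m s" and "i \<in> agents n"
  shows "agent_utility n u t i \<le> max_utility n s u i"
  unfolding agent_utility_def
  by (intro member_utility_le_max_utility own_team_in_coalitions_of[OF assms])

text \<open>Any existing team, here that of agent 1, changes nothing when it deviates to
  itself.\<close>

lemma ex_stable_coalition:
  assumes t: "t \<in> team_formations n m s" and "0 < n"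
  shows "\<exists>c\<in>coalitions n s. \<forall>i\<in>c. member_utility u c i = agent_utility n u t i"
proof
  have 1: "1 \<in> agents n" using \<open>0 < n\<close> by (simp add: agents_def)
  show "own_team n t 1 \<in> coalitions n s"
    using own_team_in_coalitions_of[OF t 1] by (simp add: coalitions_of_def)
  show "\<forall>i\<in>own_team n t 1. member_utility u (own_team n t 1) i = agent_utility n u t i"
    by (simp add: agent_utility_def own_team_def)
qed

text \<open>Turns the \<open>Max\<close> into one inequality per coalition, the shape of the
  constraints on \<open>r\<close>. The coalition from \<open>ex_stable_coalition\<close> has uplift
  0, which gives both nonemptiness of the set and the lower bound 0.\<close>

lemma max_uplift_le_iff:
  assumes t: "t \<in> team_formations n m s" and "0 < n"
  shows "real_of_int (max_uplift n s u t) \<le> r \<longleftrightarrow>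
    (\<forall>c\<in>coalitions n s. (\<forall>i\<in>c. agent_utility n u t i \<le> member_utility u c i) \<longrightarrow>
        real_of_int (uplift n u c t) \<le> r)"
    and max_uplift_nonneg: "0 \<le> max_uplift n s u t"
proof -
  let ?S = "{uplift n u c t | c. c \<in> coalitions n s \<and>
            (\<forall>i\<in>c. member_utility u c i \<ge> agent_utility n u t i)}"
  have fin: "finite ?S" by simp
  obtain c where c: "c \<in> coalitions n s"
    and eq: "\<forall>i\<in>c. member_utility u c i = agent_utility n u t i"
    using ex_stable_coalition[OF assms] by blast
  from eq have "uplift n u c t = 0" by (simp add: uplift_def)
  with c eq have mem: "0 \<in> ?S" by (auto intro!: exI[of _ c])
  show "0 \<le> max_uplift n s u t"
    unfolding max_uplift_def using fin mem by (rule Max_ge)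
  have "max_uplift n s u t \<in> ?S"
    unfolding max_uplift_def by (rule Max_in) (use fin mem in auto)
  moreover have "\<forall>a\<in>?S. a \<le> max_uplift n s u t"
    unfolding max_uplift_def using fin by (auto intro!: Max_ge)
  ultimately show "real_of_int (max_uplift n s u t) \<le> r \<longleftrightarrow>
    (\<forall>c\<in>coalitions n s. (\<forall>i\<in>c. agent_utility n u t i \<le> member_utility u c i) \<longrightarrow>
        real_of_int (uplift n u c t) \<le> r)"
    by (smt (verit) mem_Collect_eq of_int_le_iff)
qed

section \<open>The constraints for a fixed team formation\<close>

text \<open>Only the term at \<open>a\<close> can survive. The lower limit \<open>b\<close> is kept
  free: 0 serves the normalization and the utility sums, \<open>member_utility u c i + 1\<close> the
  penalty sums.\<close>

lemma one_hot_sum: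
  fixes a U :: nat
  assumes "\<forall>v\<in>{0..U}. f v = (of_bool (v = a) :: real)" and "a \<le> U"
  shows "(\<Sum>v = b..U. g v * f v) = g a * of_bool (b \<le> a)"
proof -
  have "(\<Sum>v = b..U. g v * f v) = (\<Sum>v = b..U. if v = a then g a else 0)"
    using assms(1) by (intro sum.cong) auto
  then show ?thesis using assms(2) by simp
qed

text \<open>For \<open>k = t i\<close> the two inequalities squeeze \<open>w\<close> to
  \<open>x j k\<close>, the indicator of \<open>t j = t i\<close>. The inequalities for the other
  teams hold for every binary \<open>w\<close>.\<close>

lemma represents_teammates:
  assumes t: "t \<in> team_formations n m s" and x: "represents n m x t"
    and i: "i \<in> agents n" and j: "j \<in> agents n" and w: "w \<in> {0, 1 :: real}"
  shows "(\<forall>k\<in>teams m. w \<ge> x i k + x j k - 1 \<and> w + x i k \<le> x j k + 1)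
    \<longleftrightarrow> w = of_bool (t i = t j)"
proof -
  have ti: "t i \<in> teams m" "t j \<in> teams m"
    using t i j by (auto simp: team_formations_def)
  have val: "x i k = of_bool (t i = k)" if "i \<in> agents n" "k \<in> teams m" for i k
    using x that by (force simp: represents_def)
  show ?thesis
  proof
    assume "\<forall>k\<in>teams m. w \<ge> x i k + x j k - 1 \<and> w + x i k \<le> x j k + 1"
    with ti have "w \<ge> x i (t i) + x j (t i) - 1 \<and> w + x i (t i) \<le> x j (t i) + 1" by blast
    then show "w = of_bool (t i = t j)"
      using w val[OF i ti(1)] val[OF j ti(1)] by (auto split: if_splits)
  qed (use val i j in auto)
qed

lemma sum_teammates_utility:
  assumes "i \<in> agents n" and "u i i = 0"
    and "\<forall>j\<in>agents n - {i}. w i j = (of_bool (t i = t j) :: real)"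
  shows "(\<Sum>j\<in>agents n - {i}. real (u i j) * w i j) = real (agent_utility n u t i)"
proof -
  have "(\<Sum>j\<in>agents n - {i}. real (u i j) * w i j)
      = (\<Sum>j\<in>agents n - {i}. real (u i j) * of_bool (t j = t i))"
    using assms(3) by (intro sum.cong) auto
  \<comment> \<open>The term \<open>j = i\<close> may be added because \<open>u i i = 0\<close>, as
    \<open>own_team n t i\<close> contains \<open>i\<close>.\<close>
  also have "\<dots> = (\<Sum>j\<in>agents n. real (u i j) * of_bool (t j = t i))"
    using assms(2) by (intro sum.mono_neutral_left) auto
  also have "\<dots> = (\<Sum>j\<in>own_team n t i. real (u i j))"
    by (simp add: own_team_def Int_def)
  finally show ?thesis by (simp add: agent_utility_def member_utility_def)
qed

text \<open>The sign of \<open>r\<close> matters only if some member loses by deviating. The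
  disjunction in the last hypothesis leaves it open otherwise, so that \<open>0 \<le> r\<close> can
  itself be derived from the constraint of a team.\<close>

lemma uplift_constraint_iff:
  assumes c: "finite c"
    and a: "\<And>i. i \<in> c \<Longrightarrow> agent_utility n u t i \<le> U i"
    and z: "\<And>i. i \<in> c \<Longrightarrow> \<forall>v\<in>{0..U i}. z i v = (of_bool (v = agent_utility n u t i) :: real)"
    and r: "(\<forall>i\<in>c. agent_utility n u t i \<le> member_utility u c i) \<or> 0 \<le> r"
  shows "r \<ge> real (coalition_utility u c)
             - (\<Sum>i\<in>c. \<Sum>v = 0..U i. real v * z i v)
             - (\<Sum>i\<in>c. \<Sum>v = member_utility u c i + 1..U i. real (coalition_utility u c) * z i v)
     \<longleftrightarrow> ((\<forall>i\<in>c. agent_utility n u t i \<le> member_utility u c i) \<longrightarrow>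
            real_of_int (uplift n u c t) \<le> r)"
    (is "r \<ge> ?K - ?A - ?B \<longleftrightarrow> _")
proof -
  have A: "?A = (\<Sum>i\<in>c. real (agent_utility n u t i))"
    by (intro sum.cong refl, subst one_hot_sum[OF z a]) auto
  \<comment> \<open>Starting one above \<open>member_utility u c i\<close>, the inner sum hits the
    one-hot level exactly when agent \<open>i\<close> strictly loses.\<close>
  have B: "?B = (\<Sum>i\<in>c. ?K * of_bool (member_utility u c i < agent_utility n u t i))"
    by (intro sum.cong refl, subst one_hot_sum[OF z a]) (auto simp: Suc_le_eq)
  show ?thesis
  proof (cases "\<forall>i\<in>c. agent_utility n u t i \<le> member_utility u c i")
    case True
    then have "?B = 0" unfolding B by (intro sum.neutral) auto
    moreover have "?K - ?A = real_of_int (uplift n u c t)"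
      unfolding A by (simp add: uplift_def coalition_utility_def member_utility_def sum_subtractf)
    ultimately show ?thesis using True by simp
  next
    case False
    then obtain i where i: "i \<in> c" "member_utility u c i < agent_utility n u t i" by force
    \<comment> \<open>A single losing member already contributes all of \<open>?K\<close>, and the
      other summands are nonnegative.\<close>
    have "?K * of_bool (member_utility u c i < agent_utility n u t i) \<le> ?B"
      unfolding B by (rule member_le_sum) (use i c in auto)
    moreover have "0 \<le> ?A" unfolding A by (simp add: sum_nonneg)
    ultimately have "?K - ?A - ?B \<le> 0" using i by simp
    then show ?thesis using False r by linarith
  qed
qed

section \<open>Feasible solutions and team formations\<close>

text \<open>Each row of \<open>x\<close> is one-hot and so selects a team; the column sums count the
  members of each team.\<close>

lemma SL_feasible_imp_represents:
  assumes "SL_feasible n m s u x w z r"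
  shows "\<exists>t\<in>team_formations n m s. represents n m x t"
proof -
  have "\<exists>k\<in>teams m. \<forall>l\<in>teams m. x i l = of_bool (l = k)" if "i \<in> agents n" for i
    using assms that by (intro binary_sum_one_imp_one_hot) (auto simp: SL_feasible_def)
  then obtain t0 where t0: "\<And>i. i \<in> agents n \<Longrightarrow> t0 i \<in> teams m"
    "\<And>i k. i \<in> agents n \<Longrightarrow> k \<in> teams m \<Longrightarrow> x i k = of_bool (k = t0 i)"
    by metis
  \<comment> \<open>Team formations are extensional, so the chosen map is cut down to the
    agents.\<close>
  define t where "t = restrict t0 (agents n)"
  have rep: "x i k = of_bool (t i = k)" if "i \<in> agents n" "k \<in> teams m" for i k
    using t0(2)[OF that] that by (auto simp: t_def)
  have "card {i \<in> agents n. t i = k} = s" if k: "k \<in> teams m" for k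
  proof -
    have "real s = (\<Sum>i\<in>agents n. x i k)" using assms k by (simp add: SL_feasible_def)
    also have "\<dots> = (\<Sum>i\<in>agents n. of_bool (t i = k))" using rep k by (intro sum.cong) auto
    also have "\<dots> = real (card {i \<in> agents n. t i = k})" by (simp add: Int_def)
    finally show ?thesis by simp
  qed
  then have "t \<in> team_formations n m s"
    using t0(1) by (auto simp: team_formations_def t_def)
  moreover have "represents n m x t" using rep by (auto simp: represents_def)
  ultimately show ?thesis by blast
qed

lemma represents_assignment:
  assumes t: "t \<in> team_formations n m s" and x: "represents n m x t"
  shows "\<forall>k\<in>teams m. (\<Sum>i\<in>agents n. x i k) = real s"
    and "\<forall>i\<in>agents n. (\<Sum>k\<in>teams m. x i k) = 1"
    and "\<forall>i\<in>agents n. \<forall>k\<in>teams m. x i k \<in> {0, 1}"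
proof -
  have val: "x i k = of_bool (t i = k)" if "i \<in> agents n" "k \<in> teams m" for i k
    using x that by (force simp: represents_def)
  show "\<forall>k\<in>teams m. (\<Sum>i\<in>agents n. x i k) = real s"
    using t by (auto simp: val team_formations_def Int_def)
  show "\<forall>i\<in>agents n. (\<Sum>k\<in>teams m. x i k) = 1"
  proof
    fix i assume i: "i \<in> agents n"
    then have "t i \<in> teams m" using t by (auto simp: team_formations_def)
    moreover have "(\<Sum>k\<in>teams m. x i k) = (\<Sum>k\<in>teams m. if t i = k then 1 else 0)"
      using i by (intro sum.cong) (auto simp: val)
    ultimately show "(\<Sum>k\<in>teams m. x i k) = 1" by simp
  qed
  show "\<forall>i\<in>agents n. \<forall>k\<in>teams m. x i k \<in> {0, 1}"
    using x unfolding represents_def by blast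
qed

text \<open>With \<open>x\<close> fixed, only \<open>r\<close> retains freedom among the entries
  that belong to the program, so both existence and the optimum can be read off.\<close>

lemma SL_feasible_iff:
  assumes n: "0 < n" and u: "\<forall>i\<in>agents n. u i i = 0"
    and t: "t \<in> team_formations n m s" and x: "represents n m x t"
  shows "SL_feasible n m s u x w z r \<longleftrightarrow>
    (\<forall>i\<in>agents n. \<forall>j\<in>agents n - {i}. w i j = of_bool (t i = t j)) \<and>
    (\<forall>i\<in>agents n. \<forall>v\<in>{0..max_utility n s u i}. z i v = of_bool (v = agent_utility n u t i)) \<and>
    real_of_int (max_uplift n s u t) \<le> r"
    (is "?L \<longleftrightarrow> ?W \<and> ?Z \<and> ?R")
proof -
  let ?cut = "\<lambda>c. r \<ge> real (coalition_utility u c)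
             - (\<Sum>i\<in>c. \<Sum>v = 0..max_utility n s u i. real v * z i v)
             - (\<Sum>i\<in>c. \<Sum>v = member_utility u c i + 1..max_utility n s u i.
                  real (coalition_utility u c) * z i v)"
  let ?ok = "\<lambda>c. (\<forall>i\<in>c. agent_utility n u t i \<le> member_utility u c i) \<longrightarrow>
                real_of_int (uplift n u c t) \<le> r"
  have le: "agent_utility n u t i \<le> max_utility n s u i" if "i \<in> agents n" for i
    using agent_utility_le_max_utility[OF t that] .
  have sub: "i \<in> agents n" if "c \<in> coalitions n s" "i \<in> c" for c i
    using that by (auto simp: coalitions_def)
  have cut: "?cut c \<longleftrightarrow> ?ok c" if "?Z"
    "(\<forall>i\<in>c. agent_utility n u t i \<le> member_utility u c i) \<or> 0 \<le> r" "c \<in> coalitions n s" for c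
    using that le sub by (intro uplift_constraint_iff finite_coalition) auto
  show ?thesis
  proof
    assume L: ?L
    have W: ?W
    proof (intro ballI)
      fix i j assume "i \<in> agents n" "j \<in> agents n - {i}"
      then show "w i j = of_bool (t i = t j)"
        using L by (subst represents_teammates[OF t x, symmetric]) (auto simp: SL_feasible_def)
    qed
    have Z: ?Z
    proof
      fix i assume i: "i \<in> agents n"
      have "\<exists>a\<in>{0..max_utility n s u i}. \<forall>v\<in>{0..max_utility n s u i}. z i v = of_bool (v = a)"
        using L i by (intro binary_sum_one_imp_one_hot) (auto simp: SL_feasible_def)
      then obtain a where a: "a \<le> max_utility n s u i"
        "\<forall>v\<in>{0..max_utility n s u i}. z i v = of_bool (v = a)" by auto
      \<comment> \<open>The constraint linking \<open>z\<close> to \<open>w\<close> identifies the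
        unknown level \<open>a\<close> with the agent's utility.\<close>
      have "real a = (\<Sum>v = 0..max_utility n s u i. real v * z i v)"
        using one_hot_sum[OF a(2,1), of real 0] by simp
      also have "\<dots> = (\<Sum>j\<in>agents n - {i}. real (u i j) * w i j)"
        using L i by (simp add: SL_feasible_def)
      also have "\<dots> = real (agent_utility n u t i)"
        using i u W by (intro sum_teammates_utility) auto
      finally show "\<forall>v\<in>{0..max_utility n s u i}. z i v = of_bool (v = agent_utility n u t i)"
        using a by simp
    qed
    have cuts: "\<forall>c\<in>coalitions n s. ?cut c"
      using L unfolding SL_feasible_def by blast
    \<comment> \<open>The sign of \<open>r\<close> comes first: \<open>cut\<close> applies to this
      coalition without it, and yields the \<open>0 \<le> r\<close> required for coalitions with a
      losing member.\<close>
    obtain c where c: "c \<in> coalitions n s"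
      and eq: "\<forall>i\<in>c. member_utility u c i = agent_utility n u t i"
      using ex_stable_coalition[OF t n] by blast
    have "?cut c" using cuts c by (rule bspec)
    then have "?ok c" using cut[OF Z _ c] eq by (metis order_refl)
    then have "0 \<le> r" using eq by (simp add: uplift_def)
    with cuts cut Z have ?R
      unfolding max_uplift_le_iff[OF t n] by blast
    with W Z show "?W \<and> ?Z \<and> ?R" by blast
  next
    assume R: "?W \<and> ?Z \<and> ?R"
    have r: "0 \<le> r" using max_uplift_nonneg[OF t n, of u] R by linarith
    have "\<forall>c\<in>coalitions n s. ?cut c"
      using cut R r unfolding max_uplift_le_iff[OF t n] by blast
    moreover have "\<forall>i\<in>agents n. \<forall>j\<in>agents n. i \<noteq> j \<longrightarrow> w i j \<in> {0, 1}"
      using R by auto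
    moreover have "\<forall>i\<in>agents n. \<forall>j\<in>agents n. i \<noteq> j \<longrightarrow>
        (\<forall>k\<in>teams m. w i j \<ge> x i k + x j k - 1 \<and> w i j + x i k \<le> x j k + 1)"
    proof (intro ballI impI)
      fix i j k assume ij: "i \<in> agents n" "j \<in> agents n" "i \<noteq> j" and k: "k \<in> teams m"
      then have "w i j = of_bool (t i = t j)" using R by blast
      then show "w i j \<ge> x i k + x j k - 1 \<and> w i j + x i k \<le> x j k + 1"
        using represents_teammates[OF t x ij(1,2), of "w i j"] k by auto
    qed
    moreover have "\<forall>i\<in>agents n. (\<Sum>v = 0..max_utility n s u i. z i v) = 1"
    proof
      fix i assume "i \<in> agents n"
      then show "(\<Sum>v = 0..max_utility n s u i. z i v) = 1"
        using one_hot_sum[of _ "z i" "agent_utility n u t i" "\<lambda>_. 1" 0] R le by simp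
    qed
    moreover have "\<forall>i\<in>agents n. (\<Sum>v = 0..max_utility n s u i. real v * z i v)
        = (\<Sum>j\<in>agents n - {i}. real (u i j) * w i j)"
    proof
      fix i assume i: "i \<in> agents n"
      then have "(\<Sum>j\<in>agents n - {i}. real (u i j) * w i j) = real (agent_utility n u t i)"
        using u R by (intro sum_teammates_utility) auto
      then show "(\<Sum>v = 0..max_utility n s u i. real v * z i v)
          = (\<Sum>j\<in>agents n - {i}. real (u i j) * w i j)"
        using one_hot_sum[of _ "z i" "agent_utility n u t i" real 0] R le i by simp
    qed
    moreover have "\<forall>i\<in>agents n. \<forall>v\<in>{0..max_utility n s u i}. z i v \<in> {0, 1}"
      using R by auto
    ultimately show ?L
      unfolding SL_feasible_def using represents_assignment[OF t x] by blast
  qed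
qed

theorem theorem1:
  fixes n m s :: nat and u :: "nat \<Rightarrow> nat \<Rightarrow> nat" and \<alpha> :: real
  assumes "0 < n" and "0 < m" and "0 < s" and "n = m * s"
    and "\<forall>i\<in>agents n. u i i = 0"
    and "0 \<le> \<alpha>" and "\<alpha> \<le> 1"
  shows "(\<forall>x. (\<exists>w z r. SL_feasible n m s u x w z r) \<longleftrightarrow>
              (\<exists>t\<in>team_formations n m s. represents n m x t)) \<and>
         (\<forall>t\<in>team_formations n m s. \<forall>x. represents n m x t \<longrightarrow>
            is_maximum {SL_objective n u \<alpha> w r | w z r. SL_feasible n m s u x w z r}
              (TFP_objective n s u \<alpha> t))"
proof -
  \<comment> \<open>The forced values of \<open>w\<close> and \<open>z\<close>, with
    \<open>r\<close> at its lower bound.\<close>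
  have feas: "SL_feasible n m s u x (\<lambda>i j. of_bool (t i = t j))
      (\<lambda>i v. of_bool (v = agent_utility n u t i)) (max_uplift n s u t)"
    if "t \<in> team_formations n m s" "represents n m x t" for t x
    using SL_feasible_iff[where u = u, OF assms(1,5) that] by simp
  \<comment> \<open>The utility part of the objective is constant over feasible solutions with this
    \<open>x\<close>; only \<open>r\<close> varies.\<close>
  have obj: "SL_objective n u \<alpha> w r =
      \<alpha> * (\<Sum>i\<in>agents n. real (agent_utility n u t i)) - (1 - \<alpha>) * r"
    if "t \<in> team_formations n m s" "represents n m x t" "SL_feasible n m s u x w z r"
    for t x w z r
  proof -
    have "\<forall>i\<in>agents n. \<forall>j\<in>agents n - {i}. w i j = of_bool (t i = t j)"
      using that SL_feasible_iff[where u = u, OF assms(1,5) that(1,2)] by blast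
    then have "(\<Sum>i\<in>agents n. \<Sum>j\<in>agents n - {i}. real (u i j) * w i j)
        = (\<Sum>i\<in>agents n. real (agent_utility n u t i))"
      using assms(5) by (intro sum.cong refl sum_teammates_utility) blast+
    then show ?thesis by (simp add: SL_objective_def)
  qed
  have "is_maximum {SL_objective n u \<alpha> w r | w z r. SL_feasible n m s u x w z r}
              (TFP_objective n s u \<alpha> t)"
    if t: "t \<in> team_formations n m s" and x: "represents n m x t" for t x
    unfolding is_maximum_def
  proof (intro conjI ballI)
    show "TFP_objective n s u \<alpha> t
        \<in> {SL_objective n u \<alpha> w r | w z r. SL_feasible n m s u x w z r}"
      using feas[OF t x] obj[OF t x feas[OF t x]] unfolding TFP_objective_def
      by (metis (mono_tags, lifting) mem_Collect_eq)
  next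
    fix b assume "b \<in> {SL_objective n u \<alpha> w r | w z r. SL_feasible n m s u x w z r}"
    then obtain w z r where b: "b = SL_objective n u \<alpha> w r"
      and f: "SL_feasible n m s u x w z r" by blast
    have "real_of_int (max_uplift n s u t) \<le> r"
      using f SL_feasible_iff[where u = u, OF assms(1,5) t x] by blast
    \<comment> \<open>Since \<open>\<alpha> \<le> 1\<close>, raising \<open>r\<close> never improves
      the objective.\<close>
    then have "(1 - \<alpha>) * real_of_int (max_uplift n s u t) \<le> (1 - \<alpha>) * r"
      using assms(7) by (intro mult_left_mono) auto
    then show "b \<le> TFP_objective n s u \<alpha> t"
      unfolding b obj[OF t x f] TFP_objective_def by simp
  qed
  then show ?thesis
    using feas SL_feasible_imp_represents by blast
qed

end
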